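(* Let $d$ be a positive integer. The distance (minimal number of flips) between any two centrally symmetric triangulations of a convex polygon with $2d+2$ vertices is not greater than $\lceil 5d/2\rceil-2$.
   Context: Let $\pi$ be a convex polygon with $2d+2$ vertices. An edge on $\pi$ is a set of two distinct vertices of $\pi$. For a vertex $x$ of $\pi$, $\bar{x}$ denotes the opposite vertex, i.e. the one separated from $x$ by exactly $d$ vertices along the boundary on either side. An edge $\{x,\bar{x}\}$ is called a diagonal of $\pi$. A triangulation of $\pi$ is a maximal set of pairwise non-crossing edges on $\pi$; it contains all boundary edges of $\pi$, and its other edges are called interior edges. A triangulation $T$ is centrally symmetric when $\{x,y\}\in T$ implies $\{\bar{x},\bar{y}\}\in T$. Flip: let $T$ be a centrally symmetric triangulation and $\{x,x'\}$ an interior edge of $T$. There is a unique quadrilateral whose four boundary edges belong to $T$ and which has $\{x,x'\}$ as one of its two diagonals; let $y,y'$ be its other two vertices. Flipping $\{x,x'\}$ in $T$ means replacing $\{x,x'\}$ and $\{\bar{x},\bar{x}'\}$ by $\{y,y'\}$ and $\{\bar{y},\bar{y}'\}$. (When $x'=\bar{x}$, one has $y'=\bar{y}$ and just one edge is replaced.) The result is again a centrally symmetric triangulation. The distance of two centrally symmetric triangulations is the minimal number of flips needed to transform one into the other. *)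

theory Defs
  imports "HOL-Analysis.Analysis" "HOL-Library.Extended_Nat"
begin

text \<open>
  A convex polygon with \<open>n\<close> vertices is given by the sequence \<open>p 0, \<dots>, p (n - 1)\<close> of its vertices in
  counterclockwise order along the boundary. A vertex is referred to by its index, and an edge is
  a set of two distinct indices.
\<close>

definition strictly_left :: "real ^ 2 \<Rightarrow> real ^ 2 \<Rightarrow> real ^ 2 \<Rightarrow> bool" where
  \<comment> \<open>\<open>c\<close> lies strictly to the left of the oriented line from \<open>a\<close> to \<open>b\<close>\<close>
  "strictly_left a b c \<longleftrightarrow>
     (b $ 1 - a $ 1) * (c $ 2 - a $ 2) - (b $ 2 - a $ 2) * (c $ 1 - a $ 1) > 0"

definition convex_polygon :: "nat \<Rightarrow> (nat \<Rightarrow> real ^ 2) \<Rightarrow> bool" where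
  "convex_polygon n p \<longleftrightarrow> n \<ge> 3 \<and>
     (\<forall>i<n. \<forall>k<n. k \<noteq> i \<longrightarrow> k \<noteq> Suc i mod n \<longrightarrow> strictly_left (p i) (p (Suc i mod n)) (p k))"

definition edges_on :: "nat \<Rightarrow> nat set set" where
  "edges_on n = {{x, y} | x y. x < n \<and> y < n \<and> x \<noteq> y}"

definition boundary_edges :: "nat \<Rightarrow> nat set set" where
  "boundary_edges n = {{i, Suc i mod n} | i. i < n}"

text \<open>Open segments are used, so distinct edges sharing a vertex do not cross.\<close>

definition crossing :: "(nat \<Rightarrow> real ^ 2) \<Rightarrow> nat set \<Rightarrow> nat set \<Rightarrow> bool" where
  "crossing p e f \<longleftrightarrow> e \<noteq> f \<and>
     (\<exists>x x' y y'. e = {x, x'} \<and> f = {y, y'} \<and>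
        open_segment (p x) (p x') \<inter> open_segment (p y) (p y') \<noteq> {})"

definition non_crossing :: "(nat \<Rightarrow> real ^ 2) \<Rightarrow> nat set set \<Rightarrow> bool" where
  "non_crossing p T \<longleftrightarrow> pairwise (\<lambda>e f. \<not> crossing p e f) T"

definition triangulation :: "nat \<Rightarrow> (nat \<Rightarrow> real ^ 2) \<Rightarrow> nat set set \<Rightarrow> bool" where
  "triangulation n p T \<longleftrightarrow> T \<subseteq> edges_on n \<and> non_crossing p T \<and>
     (\<forall>T'. T' \<subseteq> edges_on n \<longrightarrow> non_crossing p T' \<longrightarrow> T \<subseteq> T' \<longrightarrow> T' = T)"

text \<open>From here on the polygon has \<open>2 * d + 2\<close> vertices.\<close>

definition opposite :: "nat \<Rightarrow> nat \<Rightarrow> nat" where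
  "opposite d x = (x + d + 1) mod (2 * d + 2)"

definition cs_triangulation :: "nat \<Rightarrow> (nat \<Rightarrow> real ^ 2) \<Rightarrow> nat set set \<Rightarrow> bool" where
  "cs_triangulation d p T \<longleftrightarrow> triangulation (2 * d + 2) p T \<and>
     (\<forall>x y. {x, y} \<in> T \<longrightarrow> {opposite d x, opposite d y} \<in> T)"

text \<open>
  That \<open>{x, x'}\<close> and \<open>{y, y'}\<close> are the two diagonals of the quadrilateral with sides
  \<open>{x, y}\<close>, \<open>{y, x'}\<close>, \<open>{x', y'}\<close>, \<open>{y', x}\<close> is expressed by requiring them to cross.
  If \<open>x' = opposite d x\<close>, the two removed edges coincide, and so do the two inserted ones.
\<close>

definition flip :: "nat \<Rightarrow> (nat \<Rightarrow> real ^ 2) \<Rightarrow> nat set set \<Rightarrow> nat set set \<Rightarrow> bool" where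
  "flip d p T T' \<longleftrightarrow> cs_triangulation d p T \<and>
     (\<exists>x x' y y'.
        {x, x'} \<in> T - boundary_edges (2 * d + 2) \<and>
        {x, y} \<in> T \<and> {y, x'} \<in> T \<and> {x', y'} \<in> T \<and> {y', x} \<in> T \<and>
        crossing p {x, x'} {y, y'} \<and>
        T' = (T - {{x, x'}, {opposite d x, opposite d x'}})
               \<union> {{y, y'}, {opposite d y, opposite d y'}})"

text \<open>The distance is infinite if no sequence of flips leads from \<open>T\<close> to \<open>T'\<close>.\<close>

definition flip_distance ::
    "nat \<Rightarrow> (nat \<Rightarrow> real ^ 2) \<Rightarrow> nat set set \<Rightarrow> nat set set \<Rightarrow> enat" where
  "flip_distance d p T T' = (INF k \<in> {k. (flip d p ^^ k) T T'}. enat k)"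

end

theory Submission
  imports Defs
begin

text \<open>
  A centrally symmetric triangulation contains a diagonal \<open>{b, b + d + 1}\<close>, and is determined by the
  triangulation of the \<open>(d + 2)\<close>-gon on one side of it, that is, by a binary tree with \<open>d + 1\<close> leaves.
  Flips off the diagonal are rotations of this tree, and \<open>d - 1\<close> rotations reach the fan at any
  prescribed vertex. If two triangulations have the same diagonal, meeting at a fan costs
  \<open>2 (d - 1)\<close>. If their diagonals start at \<open>a < b\<close>, turn the second one into the fan at the vertex
  \<open>a + d + 1\<close> and flip its diagonal, which gives \<open>{a, a + d + 1}\<close>. From there \<open>b - a - 1\<close> flips lead to
  the fan at \<open>a + d + 1\<close> and \<open>d - (b - a)\<close> flips to the fan at \<open>a\<close>. The smaller of these numbers is at most
  \<open>(d - 1) div 2\<close>, so meeting the first triangulation at the nearer fan costs at most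
  \<open>(d - 1) + 1 + (d - 1) div 2 + (d - 1)\<close> flips.
\<close>

subsection \<open>Crossing edges of a convex polygon\<close>

text \<open>Twice the signed area of the triangle \<open>a b c\<close>, positive for
  counterclockwise triangles.\<close>

definition orient :: "real ^ 2 \<Rightarrow> real ^ 2 \<Rightarrow> real ^ 2 \<Rightarrow> real" where
  "orient a b c = (b $ 1 - a $ 1) * (c $ 2 - a $ 2) - (b $ 2 - a $ 2) * (c $ 1 - a $ 1)"

lemma orient_rotate: "orient b c a = orient a b c"
  by (simp add: orient_def algebra_simps)

lemma orient_swap: "orient a c b = - orient a b c"
  by (simp add: orient_def algebra_simps)

lemma orient_affine:
  "orient a b ((1 - u) *\<^sub>R x + u *\<^sub>R y) = (1 - u) * orient a b x + u * orient a b y"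
  by (simp add: orient_def algebra_simps)

text \<open>The three-term Grassmann-Pluecker relation for the vectors from \<open>o'\<close> to the
  other four points.\<close>

lemma orient_plucker:
  "orient o' a b * orient o' c d - orient o' a c * orient o' b d + orient o' a d * orient o' b c = 0"
  by (simp add: orient_def algebra_simps)

text \<open>Convexity is given only along the sides of the polygon. All other triples follow by
  induction on \<open>k\<close>: in the Pluecker relation at \<open>p i\<close> for
  \<open>Suc i\<close>, \<open>j\<close>, \<open>k\<close>, \<open>Suc k\<close>, every factor
  except the orientation in question is known to be positive.\<close>

lemma convex_polygon_orient:
  assumes "convex_polygon n p" "i < j" "j < k" "k < n"
  shows "orient (p i) (p j) (p k) > 0"
proof -
  have edge: "orient (p i) (p (Suc i)) (p k) > 0"
    if "Suc i < n" "k < n" "k \<noteq> i" "k \<noteq> Suc i" for i k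
  proof -
    have "Suc i mod n = Suc i" using that by simp
    with assms(1) that have "strictly_left (p i) (p (Suc i)) (p k)"
      unfolding convex_polygon_def by (metis Suc_lessD)
    then show ?thesis by (simp add: strictly_left_def orient_def)
  qed
  show ?thesis
    using assms(3,4)
  proof (induction k)
    case (Suc k)
    have last: "orient (p i) (p k) (p (Suc k)) > 0" if "i < k"
      using edge[of k i] that Suc.prems orient_rotate by simp
    show ?case
    proof (cases "j = k")
      case True
      then show ?thesis using last assms(2) by simp
    next
      case False
      then have jk: "j < k" using Suc.prems by simp
      let ?o = "\<lambda>b c. orient (p i) (p b) (p c)"
      show ?thesis
      proof (cases "j = Suc i")
        case True
        then show ?thesis using edge[of i "Suc k"] Suc.prems by simp
      next
        case False
        have pos: "?o (Suc i) j > 0" "?o (Suc i) k > 0" "?o (Suc i) (Suc k) > 0"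
          using edge[of i] Suc.prems jk assms(2) False by auto
        have "?o (Suc i) j * ?o k (Suc k) > 0" "?o (Suc i) (Suc k) * ?o j k > 0"
          using pos last Suc.IH Suc.prems jk assms(2) by auto
        then have "?o (Suc i) k * ?o j (Suc k) > 0"
          using orient_plucker[of "p i" "p (Suc i)" "p j" "p k" "p (Suc k)"] by linarith
        then show ?thesis
          using pos(2) by (simp add: zero_less_mult_iff)
      qed
    qed
  qed simp
qed

text \<open>Either diagonal of a convex quadrilateral is divided by the other in the ratio of the
  two triangles that the other cuts off; this gives the parameters \<open>u\<close> and
  \<open>v\<close>. The number \<open>s\<close> is twice the area of the quadrilateral, and
  \<open>s2\<close> computes it along the other diagonal.\<close>

lemma open_segments_meet:
  assumes "orient a b c > 0" "orient a b e > 0" "orient a c e > 0" "orient b c e > 0"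
  shows "open_segment a c \<inter> open_segment b e \<noteq> {}"
proof -
  define s where "s = orient a b c + orient a c e"
  have s2: "s = orient a b e + orient b c e" and s: "s > 0"
    using assms by (simp_all add: s_def orient_def algebra_simps)
  define u v where "u = orient a b e / s" and "v = orient a b c / s"
  have u: "0 < u" "u < 1" "1 - u = orient b c e / s"
    using assms s s2 by (auto simp: u_def field_simps)
  have v: "0 < v" "v < 1" "1 - v = orient a c e / s"
    using assms s s_def by (auto simp: v_def field_simps)
  \<comment> \<open>The affine dependence of four points in the plane, read coordinatewise.\<close>
  have comp: "orient b c e * a $ i + orient a b e * c $ i
      = orient a c e * b $ i + orient a b c * e $ i" if "i = 1 \<or> i = 2" for i :: 2
    using that by (auto simp: orient_def algebra_simps)
  have "((1 - u) *\<^sub>R a + u *\<^sub>R c) $ i = ((1 - v) *\<^sub>R b + v *\<^sub>R e) $ i" for i :: 2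
    using comp[of i] s exhaust_2[of i] unfolding u(3) v(3)
    by (simp add: u_def v_def add_divide_distrib[symmetric])
  then have eq: "(1 - u) *\<^sub>R a + u *\<^sub>R c = (1 - v) *\<^sub>R b + v *\<^sub>R e"
    by (simp add: vec_eq_iff)
  have "a \<noteq> c" "b \<noteq> e"
    using assms by (auto simp: orient_def algebra_simps)
  then have "(1 - u) *\<^sub>R a + u *\<^sub>R c \<in> open_segment a c \<inter> open_segment b e"
    using u(1,2) v(1,2) eq by (auto simp: in_segment)
  then show ?thesis by blast
qed

text \<open>\<open>orient a c\<close> vanishes on the line through \<open>a\<close> and
  \<open>c\<close> and is affine along the segment from \<open>b\<close> to \<open>e\<close>. Weakly
  equal signs at the ends, not both zero, leave no zero in the interior. The second assumption
  excludes collinear overlaps.\<close>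

lemma open_segments_disjoint:
  assumes "(orient a c b \<ge> 0 \<and> orient a c e \<ge> 0) \<or> (orient a c b \<le> 0 \<and> orient a c e \<le> 0)"
    and "orient a c b \<noteq> 0 \<or> orient a c e \<noteq> 0"
  shows "open_segment a c \<inter> open_segment b e = {}"
proof -
  have False if x: "x \<in> open_segment a c" "x \<in> open_segment b e" for x
  proof -
    obtain u where "x = (1 - u) *\<^sub>R a + u *\<^sub>R c"
      using x(1) by (auto simp: in_segment)
    then have 0: "orient a c x = 0"
      by (simp add: orient_affine) (simp add: orient_def)
    obtain v where v: "x = (1 - v) *\<^sub>R b + v *\<^sub>R e" "0 < v" "v < 1"
      using x(2) by (auto simp: in_segment)
    let ?B = "(1 - v) * orient a c b" and ?E = "v * orient a c e"
    have sum: "?B + ?E = 0" using 0 v(1) by (simp add: orient_affine)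
    have "(?B \<ge> 0 \<and> ?E \<ge> 0) \<or> (?B \<le> 0 \<and> ?E \<le> 0)"
      using assms(1) v(2,3) by (auto simp: mult_le_0_iff)
    with sum have "?B = 0 \<and> ?E = 0" by linarith
    with v assms(2) show False by auto
  qed
  then show ?thesis by blast
qed

text \<open>Meant for \<open>x < x'\<close> and \<open>y < y'\<close>: each pair then strictly
  separates the other in the boundary order, so edges with a common endpoint are never
  interleaved.\<close>

definition interleaved :: "nat \<Rightarrow> nat \<Rightarrow> nat \<Rightarrow> nat \<Rightarrow> bool" where
  "interleaved x x' y y' \<longleftrightarrow> (x < y \<and> y < x' \<and> x' < y') \<or> (y < x \<and> x < y' \<and> y' < x')"

lemma crossing_iff_segments:
  "crossing p {x, x'} {y, y'} \<longleftrightarrow> {x, x'} \<noteq> {y, y'} \<and>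
     open_segment (p x) (p x') \<inter> open_segment (p y) (p y') \<noteq> {}"
proof
  assume "crossing p {x, x'} {y, y'}"
  then show "{x, x'} \<noteq> {y, y'} \<and>
     open_segment (p x) (p x') \<inter> open_segment (p y) (p y') \<noteq> {}"
    unfolding crossing_def doubleton_eq_iff by (auto simp: open_segment_commute)
qed (unfold crossing_def, blast)

lemma crossing_sym: "crossing p e f \<Longrightarrow> crossing p f e"
  unfolding crossing_def by blast

text \<open>Through this equivalence alone does the geometry enter the later arguments. Vertices
  with index strictly between \<open>x\<close> and \<open>x'\<close> lie to the right of the line
  from \<open>p x\<close> to \<open>p x'\<close>, the remaining ones to its left; if the indices are
  not interleaved, \<open>p y\<close> and \<open>p y'\<close> are therefore on one closed
  side.\<close>

lemma crossing_iff:
  assumes p: "convex_polygon n p" and "x < x'" "x' < n" "y < y'" "y' < n"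
  shows "crossing p {x, x'} {y, y'} \<longleftrightarrow> interleaved x x' y y'"
proof (cases "interleaved x x' y y'")
  case True
  have meet: "open_segment (p i) (p k) \<inter> open_segment (p j) (p l) \<noteq> {}"
    if "i < j" "j < k" "k < l" "l < n" for i j k l
    using that by (intro open_segments_meet convex_polygon_orient[OF p]) auto
  have "{x, x'} \<noteq> {y, y'}"
    using True by (auto simp: interleaved_def doubleton_eq_iff)
  moreover have "open_segment (p x) (p x') \<inter> open_segment (p y) (p y') \<noteq> {}"
    using True meet[of x y x' y'] meet[of y x y' x'] assms
    unfolding interleaved_def by (auto simp: Int_commute)
  ultimately show ?thesis using True by (simp add: crossing_iff_segments)
next
  case False
  let ?o = "orient (p x) (p x')"
  have inner: "?o (p z) < 0" if "x < z" "z < x'" for z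
    using convex_polygon_orient[OF p, of x z x'] that assms orient_swap[of "p x" "p x'" "p z"]
    by simp
  have outer: "?o (p z) > 0" if "z < x \<or> x' < z" "z < n" for z
    using convex_polygon_orient[OF p, of z x x'] convex_polygon_orient[OF p, of x x' z]
      that assms orient_rotate by auto
  have on: "?o (p x) = 0" "?o (p x') = 0" by (simp_all add: orient_def)
  have "open_segment (p x) (p x') \<inter> open_segment (p y) (p y') = {}" if "{x, x'} \<noteq> {y, y'}"
  proof (rule open_segments_disjoint)
    have cases: "(x \<le> y \<and> y' \<le> x') \<or> ((y \<le> x \<or> x' \<le> y) \<and> (y' \<le> x \<or> x' \<le> y'))"
      using False assms unfolding interleaved_def by linarith
    have le: "?o (p z) \<le> 0" if "x \<le> z" "z \<le> x'" for z
      using that inner[of z] on by (cases "z = x"; cases "z = x'") auto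
    have ge: "?o (p z) \<ge> 0" if "z \<le> x \<or> x' \<le> z" "z < n" for z
      using that outer[of z] on by (cases "z = x"; cases "z = x'") auto
    have nz: "?o (p z) \<noteq> 0" if "z \<noteq> x" "z \<noteq> x'" "z < n" for z
      using that inner[of z] outer[of z] by (metis less_irrefl nat_neq_iff)
    show "(?o (p y) \<ge> 0 \<and> ?o (p y') \<ge> 0) \<or> (?o (p y) \<le> 0 \<and> ?o (p y') \<le> 0)"
      using cases le[of y] le[of y'] ge[of y] ge[of y'] assms by auto
    show "?o (p y) \<noteq> 0 \<or> ?o (p y') \<noteq> 0"
      using nz[of y] nz[of y'] that assms by (metis less_asym less_trans)
  qed
  then show ?thesis using False by (auto simp: crossing_iff_segments)
qed

lemma edges_on_cases:
  assumes "e \<in> edges_on n"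
  obtains x y where "e = {x, y}" "x < y" "y < n"
  using assms unfolding edges_on_def
  by (smt (verit) insert_commute linorder_neqE_nat mem_Collect_eq)

lemma edges_onI: "x < y \<Longrightarrow> y < n \<Longrightarrow> {x, y} \<in> edges_on n"
  unfolding edges_on_def by force

subsection \<open>Opposite vertices\<close>

lemma opposite_le: "x \<le> d \<Longrightarrow> opposite d x = x + d + 1"
  by (simp add: opposite_def)

lemma opposite_gt: "d < x \<Longrightarrow> x < 2 * d + 2 \<Longrightarrow> opposite d x = x - (d + 1)"
  by (simp add: opposite_def mod_if)

lemma opposite_less: "opposite d x < 2 * d + 2"
  by (simp add: opposite_def)

lemma opposite_opposite: "x < 2 * d + 2 \<Longrightarrow> opposite d (opposite d x) = x"
  by (cases "x \<le> d") (simp_all add: opposite_le opposite_gt)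

lemma opposite_inj: "inj_on (opposite d) {..<2 * d + 2}"
  by (rule inj_on_inverseI[where g = "opposite d"]) (simp add: opposite_opposite)

lemma edges_on_opposite:
  assumes "e \<in> edges_on (2 * d + 2)"
  shows "opposite d ` e \<in> edges_on (2 * d + 2)"
proof -
  obtain x y where e: "e = {x, y}" "x < y" "y < 2 * d + 2"
    using assms by (rule edges_on_cases)
  then have "opposite d x \<noteq> opposite d y"
    using inj_onD[OF opposite_inj, of d x y] by auto
  then show ?thesis
    using e opposite_less by (auto simp: edges_on_def)
qed

lemma opposite_opposite_image:
  assumes "e \<in> edges_on (2 * d + 2)"
  shows "opposite d ` opposite d ` e = e"
  using assms by (rule edges_on_cases) (simp add: opposite_opposite)

text \<open>The half turn preserves the cyclic order. The cases count how many of the four indices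
  exceed \<open>d\<close>; in each one the endpoints are listed in increasing order, as
  \<open>crossing_iff\<close> requires.\<close>

lemma crossing_opposite_interleaved:
  assumes p: "convex_polygon (2 * d + 2) p" and ijkl: "i < j" "j < k" "k < l" "l < 2 * d + 2"
  shows "crossing p {opposite d i, opposite d k} {opposite d j, opposite d l}"
proof -
  note cr = crossing_iff[OF p]
  note simps = opposite_le opposite_gt cr interleaved_def
  have "i < 2 * d + 2" "j < 2 * d + 2" "k < 2 * d + 2" using ijkl by auto
  note ijkl = ijkl this
  consider "l \<le> d" | "k \<le> d" "d < l" | "j \<le> d" "d < k" | "i \<le> d" "d < j" | "d < i"
    by linarith
  then show ?thesis
  proof cases
    case 1
    then show ?thesis using ijkl by (simp add: simps)
  next
    case 2
    then have "crossing p {opposite d i, opposite d k} {opposite d l, opposite d j}"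
      using ijkl by (simp add: simps)
    then show ?thesis by (simp add: insert_commute)
  next
    case 3
    then have "crossing p {opposite d k, opposite d i} {opposite d l, opposite d j}"
      using ijkl by (simp add: simps) arith
    then show ?thesis by (simp add: insert_commute)
  next
    case 4
    then have "crossing p {opposite d k, opposite d i} {opposite d j, opposite d l}"
      using ijkl by (simp add: simps) arith
    then show ?thesis by (simp add: insert_commute)
  next
    case 5
    then show ?thesis using ijkl by (simp add: simps) arith
  qed
qed

lemma crossing_opposite:
  assumes p: "convex_polygon (2 * d + 2) p"
    and ef: "e \<in> edges_on (2 * d + 2)" "f \<in> edges_on (2 * d + 2)" and cr: "crossing p e f"
  shows "crossing p (opposite d ` e) (opposite d ` f)"
proof -
  obtain x x' where e: "e = {x, x'}" "x < x'" "x' < 2 * d + 2"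
    using ef(1) by (rule edges_on_cases)
  obtain y y' where f: "f = {y, y'}" "y < y'" "y' < 2 * d + 2"
    using ef(2) by (rule edges_on_cases)
  have "interleaved x x' y y'"
    using cr crossing_iff[OF p e(2,3) f(2,3)] by (simp add: e(1) f(1))
  then show ?thesis
    using crossing_opposite_interleaved[OF p, of x y x' y'] e f
      crossing_opposite_interleaved[OF p, of y x y' x']
    by (auto simp: interleaved_def intro: crossing_sym)
qed

subsection \<open>Bounded reachability\<close>

definition reach :: "('a \<Rightarrow> 'a \<Rightarrow> bool) \<Rightarrow> nat \<Rightarrow> 'a \<Rightarrow> 'a \<Rightarrow> bool" where
  "reach r k x y \<longleftrightarrow> (\<exists>j\<le>k. (r ^^ j) x y)"

lemma reach_refl: "reach r k x x"
  unfolding reach_def by (intro exI[of _ 0]) simp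

lemma reach_step: "r x y \<Longrightarrow> reach r (Suc 0) x y"
  unfolding reach_def by (intro exI[of _ 1]) (simp add: relcompp_apply)

lemma reach_mono: "reach r j x y \<Longrightarrow> j \<le> k \<Longrightarrow> reach r k x y"
  unfolding reach_def by (meson le_trans)

lemma reach_trans:
  assumes "reach r j x y" "reach r k y z"
  shows "reach r (j + k) x z"
proof -
  obtain a b where "a \<le> j" "(r ^^ a) x y" "b \<le> k" "(r ^^ b) y z"
    using assms by (auto simp: reach_def)
  then have "a + b \<le> j + k" "(r ^^ (a + b)) x z"
    by (auto simp: relpowp_add)
  then show ?thesis unfolding reach_def by blast
qed

lemma reach_map:
  assumes xy: "reach r k x y" and P: "P x"
    and step: "\<And>u v. P u \<Longrightarrow> r u v \<Longrightarrow> s (f u) (f v) \<and> P v"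
  shows "reach s k (f x) (f y)"
proof -
  have "(s ^^ j) (f x) (f y) \<and> P y" if "(r ^^ j) x y" for j y
    using that
  proof (induction j arbitrary: y)
    case (Suc j)
    then show ?case using step by auto
  qed (use P in simp)
  with xy show ?thesis by (auto simp: reach_def)
qed

lemma reach_sym:
  assumes "reach r k x y" "\<And>u v. r u v \<Longrightarrow> r v u"
  shows "reach r k y x"
proof -
  have "(r ^^ j) x y \<Longrightarrow> (r ^^ j) y x" for j y
  proof (induction j arbitrary: y)
    case (Suc j)
    then obtain z where "(r ^^ j) z x" "r y z" using assms(2) by auto
    then show ?case by (rule relpowp_Suc_I2[rotated])
  qed simp
  with assms(1) show ?thesis by (auto simp: reach_def)
qed

subsection \<open>Triangulations as binary trees\<close>

text \<open>For \<open>n > 1\<close>, a tree with \<open>n\<close> leaves stands for a triangulation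
  of a polygon with \<open>n + 1\<close> vertices: leaves are consecutive sides, the root is the
  remaining side, and the children of a node meet at the apex of the triangle on its edge.\<close>

datatype tree = Leaf | Node tree tree

primrec leaves :: "tree \<Rightarrow> nat" where
  "leaves Leaf = 1"
| "leaves (Node a b) = leaves a + leaves b"

primrec tedges :: "nat \<Rightarrow> tree \<Rightarrow> nat set set" where
  "tedges l Leaf = {{l, Suc l}}"
| "tedges l (Node a b) =
     insert {l, l + leaves a + leaves b} (tedges l a \<union> tedges (l + leaves a) b)"

lemma leaves_pos: "0 < leaves t"
  by (induction t) auto

lemma tedges_range:
  "e \<in> tedges l t \<Longrightarrow> \<exists>x y. e = {x, y} \<and> l \<le> x \<and> x < y \<and> y \<le> l + leaves t"
proof (induction t arbitrary: l)
  case (Node a b)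
  then consider "e = {l, l + leaves a + leaves b}" | "e \<in> tedges l a" | "e \<in> tedges (l + leaves a) b"
    by auto
  then show ?case
  proof cases
    case 1
    then show ?thesis
      using leaves_pos[of a] by (intro exI[of _ l] exI[of _ "l + leaves a + leaves b"]) auto
  next
    case 2
    then obtain x y where "e = {x, y}" "l \<le> x" "x < y" "y \<le> l + leaves a"
      using Node.IH(1) by blast
    then show ?thesis by (intro exI[of _ x] exI[of _ y]) auto
  next
    case 3
    then obtain x y where "e = {x, y}" "l + leaves a \<le> x" "x < y" "y \<le> l + leaves a + leaves b"
      using Node.IH(2) by blast
    then show ?thesis by (intro exI[of _ x] exI[of _ y]) auto
  qed
qed auto

lemma tedges_doubleton_range:
  "{x, y} \<in> tedges l t \<Longrightarrow> x < y \<Longrightarrow> l \<le> x \<and> y \<le> l + leaves t"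
  using tedges_range[of "{x, y}" l t] by (auto simp: doubleton_eq_iff)

lemma tedges_root: "{l, l + leaves t} \<in> tedges l t"
  by (cases t) (auto simp: add.assoc)

lemma tedges_not_interleaved:
  assumes "{x, x'} \<in> tedges l t" "{y, y'} \<in> tedges l t" "x < x'" "y < y'"
  shows "\<not> interleaved x x' y y'"
  using assms
proof (induction t arbitrary: l)
  case Leaf
  then show ?case by (auto simp: interleaved_def doubleton_eq_iff)
next
  case (Node a b)
  let ?m = "l + leaves a"
  have rng: "{u, v} = {l, ?m + leaves b} \<or> ({u, v} \<in> tedges l a \<and> l \<le> u \<and> v \<le> ?m)
      \<or> ({u, v} \<in> tedges ?m b \<and> ?m \<le> u \<and> v \<le> ?m + leaves b)"
    if "{u, v} \<in> tedges l (Node a b)" "u < v" for u v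
    using that tedges_doubleton_range[of u v] by auto
  show ?case
    using rng[OF Node.prems(1,3)] rng[OF Node.prems(2,4)] Node.IH(1)[of l] Node.IH(2)[of ?m]
      Node.prems(3,4)
    by (elim disjE) (auto simp: interleaved_def doubleton_eq_iff)
qed

text \<open>A missing chord inside the range of one subtree is handled by induction. A chord passing
  over the apex \<open>?m\<close> differs from the root edge, so it crosses the root edge of the
  left or of the right subtree.\<close>

lemma tedges_maximal:
  assumes "l \<le> x" "x < y" "y \<le> l + leaves t" "{x, y} \<notin> tedges l t"
  shows "\<exists>u v. {u, v} \<in> tedges l t \<and> u < v \<and> interleaved x y u v"
  using assms
proof (induction t arbitrary: l)
  case Leaf
  then show ?case by (auto simp: le_Suc_eq doubleton_eq_iff)
next
  case (Node a b)
  let ?m = "l + leaves a"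
  consider "y \<le> ?m" | "?m \<le> x" | "x < ?m" "?m < y" by linarith
  then show ?case
  proof cases
    case 1
    then show ?thesis using Node.IH(1)[of l] Node.prems by auto
  next
    case 2
    then show ?thesis using Node.IH(2)[of ?m] Node.prems by (auto simp: add.assoc)
  next
    case 3
    have "x \<noteq> l \<or> y \<noteq> ?m + leaves b" using Node.prems by auto
    then consider "l < x" | "y < ?m + leaves b" using Node.prems by fastforce
    then show ?thesis
    proof cases
      case 1
      have "{l, ?m} \<in> tedges l (Node a b)" using tedges_root[of l a] by simp
      then show ?thesis using 1 3 unfolding interleaved_def by (meson order.strict_trans)
    next
      case 2
      have "{?m, ?m + leaves b} \<in> tedges l (Node a b)" using tedges_root[of ?m b] by simp
      then show ?thesis using 2 3 unfolding interleaved_def by (meson order.strict_trans)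
    qed
  qed
qed

lemma tedges_shift: "(`) (\<lambda>x. x + s) ` tedges l t = tedges (l + s) t"
proof (induction t arbitrary: l)
  case (Node a b)
  then show ?case by (simp add: image_Un add.commute add.left_commute)
qed simp

subsection \<open>Rotations\<close>

inductive rot :: "tree \<Rightarrow> tree \<Rightarrow> bool" where
  right: "rot (Node (Node a b) c) (Node a (Node b c))"
| left: "rot (Node a (Node b c)) (Node (Node a b) c)"
| fst: "rot a a' \<Longrightarrow> rot (Node a b) (Node a' b)"
| snd: "rot b b' \<Longrightarrow> rot (Node a b) (Node a b')"

lemma rot_sym: "rot t t' \<Longrightarrow> rot t' t"
  by (induction rule: rot.induct) (auto intro: rot.intros)

lemma rot_leaves: "rot t t' \<Longrightarrow> leaves t' = leaves t"
  by (induction rule: rot.induct) auto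

lemma reach_fst: "reach rot k a a' \<Longrightarrow> reach rot k (Node a b) (Node a' b)"
  by (rule reach_map[where P = "\<lambda>_. True" and f = "\<lambda>a. Node a b" and s = rot and r = rot]) (auto intro: rot.intros)

lemma reach_snd: "reach rot k b b' \<Longrightarrow> reach rot k (Node a b) (Node a b')"
  by (rule reach_map[where P = "\<lambda>_. True" and f = "Node a" and s = rot and r = rot]) (auto intro: rot.intros)

text \<open>In terms of edges, \<open>lcomb\<close> is the fan at the first vertex and
  \<open>rcomb\<close> the fan at the last one. The argument counts inner nodes, hence is one less
  than the number of leaves.\<close>

primrec lcomb :: "nat \<Rightarrow> tree" where
  "lcomb 0 = Leaf"
| "lcomb (Suc n) = Node (lcomb n) Leaf"

primrec rcomb :: "nat \<Rightarrow> tree" where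
  "rcomb 0 = Leaf"
| "rcomb (Suc n) = Node Leaf (rcomb n)"

lemma leaves_comb: "leaves (lcomb n) = Suc n" "leaves (rcomb n) = Suc n"
  by (induction n) auto

text \<open>One left rotation moves the root of \<open>b\<close> onto the left spine; its two
  subtrees are then absorbed in turn. So each of the \<open>leaves b - 1\<close> inner nodes of
  \<open>b\<close> costs one rotation.\<close>

lemma reach_lcomb_append:
  "reach rot (leaves b - 1) (Node (lcomb k) b) (lcomb (k + leaves b))"
proof (induction b arbitrary: k)
  case (Node c e)
  have "reach rot (1 + (leaves c - 1) + (leaves e - 1))
      (Node (lcomb k) (Node c e)) (lcomb (k + leaves c + leaves e))"
    by (intro reach_trans[OF reach_trans[OF _ reach_fst[OF Node.IH(1)]] Node.IH(2)])
      (simp add: reach_step rot.left)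
  then show ?case
    using leaves_pos[of c] leaves_pos[of e] by (simp add: add.assoc)
qed (simp add: reach_refl)

lemma reach_rcomb_append:
  "reach rot (leaves a - 1) (Node a (rcomb k)) (rcomb (k + leaves a))"
proof (induction a arbitrary: k)
  case (Node c e)
  have "reach rot (1 + (leaves e - 1) + (leaves c - 1))
      (Node (Node c e) (rcomb k)) (rcomb (k + leaves e + leaves c))"
    by (intro reach_trans[OF reach_trans[OF _ reach_snd[OF Node.IH(2)]] Node.IH(1)])
      (simp add: reach_step rot.right)
  then show ?case
    using leaves_pos[of c] leaves_pos[of e] by (simp add: add_ac)
qed (simp add: reach_refl)

text \<open>The root is on the left spine from the start, so at most the other
  \<open>leaves t - 2\<close> inner nodes need a rotation.\<close>

lemma reach_lcomb: "reach rot (leaves t - 2) t (lcomb (leaves t - 1))"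
proof (induction t)
  case (Node a b)
  have "reach rot ((leaves a - 2) + (leaves b - 1)) (Node a b) (lcomb (leaves a - 1 + leaves b))"
    by (rule reach_trans[OF reach_fst[OF Node.IH(1)] reach_lcomb_append])
  then show ?case
    using leaves_pos[of a] leaves_pos[of b] by (auto elim!: reach_mono)
qed (simp add: reach_refl)

lemma reach_rcomb: "reach rot (leaves t - 2) t (rcomb (leaves t - 1))"
proof (induction t)
  case (Node a b)
  have "reach rot ((leaves b - 2) + (leaves a - 1)) (Node a b) (rcomb (leaves b - 1 + leaves a))"
    by (rule reach_trans[OF reach_snd[OF Node.IH(2)] reach_rcomb_append])
  then show ?case
    using leaves_pos[of a] leaves_pos[of b] by (auto elim!: reach_mono simp: add.commute)
qed (simp add: reach_refl)

text \<open>The target is the fan all of whose interior edges meet at the \<open>v\<close>-th vertex.\<close>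

lemma reach_fan:
  assumes "0 < v" "v < leaves t"
  shows "reach rot (leaves t - 2) t (Node (rcomb (v - 1)) (lcomb (leaves t - v - 1)))"
  using assms
proof (induction t arbitrary: v)
  case (Node a b)
  note pos = leaves_pos[of a] leaves_pos[of b]
  \<comment> \<open>\<open>leaves a\<close> is the apex of the root triangle. If \<open>v\<close> is
    that apex, both subtrees become combs. Otherwise induction makes a fan at \<open>v\<close> in
    the subtree containing it, one rotation moves \<open>v\<close> to the apex, and the other
    subtree is absorbed into a comb.\<close>
  consider "v = leaves a" | "v < leaves a" | "leaves a < v" by linarith
  then show ?case
  proof cases
    case 1
    have "reach rot ((leaves a - 2) + (leaves b - 2)) (Node a b)
        (Node (rcomb (leaves a - 1)) (lcomb (leaves b - 1)))"
      by (rule reach_trans[OF reach_fst[OF reach_rcomb] reach_snd[OF reach_lcomb]])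
    then show ?thesis using 1 by (auto elim!: reach_mono)
  next
    case 2
    let ?R = "rcomb (v - 1)" and ?k = "leaves a - v - 1"
    have "reach rot (leaves a - 2) (Node a b) (Node (Node ?R (lcomb ?k)) b)"
      using Node.IH(1) Node.prems 2 by (intro reach_fst) auto
    moreover have "reach rot (Suc 0) (Node (Node ?R (lcomb ?k)) b) (Node ?R (Node (lcomb ?k) b))"
      by (intro reach_step rot.right)
    moreover have "reach rot (leaves b - 1) (Node ?R (Node (lcomb ?k) b))
        (Node ?R (lcomb (?k + leaves b)))"
      by (intro reach_snd reach_lcomb_append)
    ultimately have "reach rot (leaves a - 2 + Suc 0 + (leaves b - 1)) (Node a b)
        (Node ?R (lcomb (?k + leaves b)))"
      by (meson reach_trans)
    moreover have "leaves a - 2 + Suc 0 + (leaves b - 1) \<le> leaves (Node a b) - 2"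
      "?k + leaves b = leaves (Node a b) - v - 1"
      using pos 2 Node.prems by auto
    ultimately show ?thesis using reach_mono by metis
  next
    case 3
    let ?L = "lcomb (leaves a + leaves b - v - 1)" and ?k = "v - leaves a - 1"
    have "leaves b - (v - leaves a) - 1 = leaves a + leaves b - v - 1"
      using 3 Node.prems by simp
    then have "reach rot (leaves b - 2) (Node a b) (Node a (Node (rcomb ?k) ?L))"
      using Node.IH(2)[of "v - leaves a"] Node.prems 3 by (intro reach_snd) auto
    moreover have "reach rot (Suc 0) (Node a (Node (rcomb ?k) ?L)) (Node (Node a (rcomb ?k)) ?L)"
      by (intro reach_step rot.left)
    moreover have "reach rot (leaves a - 1) (Node (Node a (rcomb ?k)) ?L)
        (Node (rcomb (?k + leaves a)) ?L)"
      by (intro reach_fst reach_rcomb_append)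
    ultimately have "reach rot (leaves b - 2 + Suc 0 + (leaves a - 1)) (Node a b)
        (Node (rcomb (?k + leaves a)) ?L)"
      by (meson reach_trans)
    moreover have "leaves b - 2 + Suc 0 + (leaves a - 1) \<le> leaves (Node a b) - 2"
      "?k + leaves a = v - 1"
      using pos 3 Node.prems by auto
    ultimately show ?thesis using reach_mono by (metis leaves.simps(2))
  qed
qed simp

section \<open>Rotations as exchanges of edges\<close>

text \<open>The exchange on one side of the diagonal only, without its symmetric copy. Naming
  \<open>e\<close> and \<open>f\<close> makes it possible to say that \<open>e\<close> is not the
  root edge.\<close>

definition tflip :: "nat set \<Rightarrow> nat set \<Rightarrow> nat set set \<Rightarrow> nat set set \<Rightarrow> bool" where
  "tflip e f E E' \<longleftrightarrow> e \<in> E \<and> E' = E - {e} \<union> {f} \<and> (\<exists>x x' y y'. e = {x, x'} \<and> f = {y, y'} \<and>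
     Suc x < x' \<and> y < y' \<and> interleaved x x' y y' \<and>
     {x, y} \<in> E \<and> {y, x'} \<in> E \<and> {x', y'} \<in> E \<and> {y', x} \<in> E)"

lemma tflip_Un:
  assumes "tflip e f E E'" "e \<notin> F"
  shows "tflip e f (E \<union> F) (E' \<union> F)"
proof -
  have "e \<in> E" and E': "E' = E - {e} \<union> {f}" using assms by (auto simp: tflip_def)
  obtain x x' y y' where "e = {x, x'}" "f = {y, y'}" "Suc x < x'" "y < y'"
     "interleaved x x' y y'" "{x, y} \<in> E" "{y, x'} \<in> E" "{x', y'} \<in> E" "{y', x} \<in> E"
    using assms(1) unfolding tflip_def by blast
  moreover have "E' \<union> F = E \<union> F - {e} \<union> {f}" using assms(2) E' by blast
  ultimately show ?thesis
    unfolding tflip_def using \<open>e \<in> E\<close> by blast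
qed

lemma tedges_mem_le: "e \<in> tedges l t \<Longrightarrow> z \<in> e \<Longrightarrow> l \<le> z \<and> z \<le> l + leaves t"
  by (fastforce dest: tedges_range)

lemma doubleton_notin_tedges:
  "x < l \<or> l + leaves t < y \<Longrightarrow> {x, y} \<notin> tedges l t"
  "y < l \<or> l + leaves t < x \<Longrightarrow> {x, y} \<notin> tedges l t"
  using tedges_mem_le[of "{x, y}" l t] by force+

lemma tflipI:
  assumes "Suc x < x'" "y < y'" "interleaved x x' y y'" "{x, x'} \<in> E"
    "{x, y} \<in> E" "{y, x'} \<in> E" "{x', y'} \<in> E" "{y', x} \<in> E" "E' = E - {{x, x'}} \<union> {{y, y'}}"
  shows "tflip {x, x'} {y, y'} E E'"
  unfolding tflip_def using assms by blast

lemma insert_exchange: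
  "e \<notin> R \<Longrightarrow> e \<noteq> g \<Longrightarrow> insert g (insert f R) = insert g (insert e R) - {e} \<union> {f}"
  by blast

text \<open>The corners are those of the quadrilateral in which a rotation acts.
  \<open>{l, k}\<close> is kept apart because it is the edge of the rotated node, while
  \<open>R\<close> will consist of the three subtrees over the other sides.\<close>

lemma tflip_quadrilateral:
  assumes ord: "l < i" "i < j" "j < k"
    and R: "{l, i} \<in> R" "{i, j} \<in> R" "{j, k} \<in> R" "{l, j} \<notin> R" "{i, k} \<notin> R"
  shows "tflip {l, j} {i, k} (insert {l, k} (insert {l, j} R)) (insert {l, k} (insert {i, k} R))"
    and "tflip {i, k} {l, j} (insert {l, k} (insert {i, k} R)) (insert {l, k} (insert {l, j} R))"
proof -
  have ne: "{l, j} \<noteq> {l, k}" "{i, k} \<noteq> {l, k}"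
    using ord by (auto simp: doubleton_eq_iff)
  have int: "interleaved l j i k" "interleaved i k l j"
    using ord by (auto simp: interleaved_def)
  have less: "Suc l < j" "Suc i < k" "i < k" "l < j"
    using ord by auto
  have mem: "{l, i} \<in> insert g (insert e R)" "{i, j} \<in> insert g (insert e R)"
    "{j, k} \<in> insert g (insert e R)" "{i, l} \<in> insert g (insert e R)"
    "{j, i} \<in> insert g (insert e R)" "{k, j} \<in> insert g (insert e R)"
    "e \<in> insert g (insert e R)" "g \<in> insert g (insert e R)" for e g
    using R(1-3) by (simp_all add: insert_commute[of _ _ "{}"])
  have kl: "{k, l} \<in> insert {l, k} S" for S
    by (simp add: insert_commute[of _ _ "{}"])
  show "tflip {l, j} {i, k} (insert {l, k} (insert {l, j} R)) (insert {l, k} (insert {i, k} R))"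
    by (rule tflipI) (rule less int mem kl insert_exchange ne R)+
  show "tflip {i, k} {l, j} (insert {l, k} (insert {i, k} R)) (insert {l, k} (insert {l, j} R))"
    by (rule tflipI) (rule less int mem kl insert_exchange ne R)+
qed

lemma rot_tflip_base:
  fixes l a b c
  defines "i \<equiv> l + leaves a"
  defines "j \<equiv> i + leaves b"
  defines "k \<equiv> j + leaves c"
  shows "tflip {l, j} {i, k} (tedges l (Node (Node a b) c)) (tedges l (Node a (Node b c)))"
    and "tflip {i, k} {l, j} (tedges l (Node a (Node b c))) (tedges l (Node (Node a b) c))"
    and "{l, j} \<noteq> {l, k}" "{i, k} \<noteq> {l, k}"
proof -
  have ord: "l < i" "i < j" "j < k"
    using leaves_pos[of a] leaves_pos[of b] leaves_pos[of c] by (auto simp: i_def j_def k_def)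
  define R where "R = tedges l a \<union> tedges i b \<union> tedges j c"
  have eq: "tedges l (Node (Node a b) c) = insert {l, k} (insert {l, j} R)"
    "tedges l (Node a (Node b c)) = insert {l, k} (insert {i, k} R)"
    by (auto simp: R_def i_def j_def k_def add.assoc)
  have R: "{l, i} \<in> R" "{i, j} \<in> R" "{j, k} \<in> R" "{l, j} \<notin> R" "{i, k} \<notin> R"
    using tedges_root[of l a] tedges_root[of i b] tedges_root[of j c] ord
    by (auto simp: R_def i_def j_def k_def doubleton_notin_tedges)
  show "tflip {l, j} {i, k} (tedges l (Node (Node a b) c)) (tedges l (Node a (Node b c)))"
    "tflip {i, k} {l, j} (tedges l (Node a (Node b c))) (tedges l (Node (Node a b) c))"
    unfolding eq by (rule tflip_quadrilateral[OF ord R])+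
  show "{l, j} \<noteq> {l, k}" "{i, k} \<noteq> {l, k}"
    using ord by (auto simp: doubleton_eq_iff)
qed

text \<open>A node and its rotated child span the quadrilateral of the exchange; rotations deeper in
  the tree are lifted by \<open>tflip_Un\<close>. Excluding the root edge matters because that edge
  will be the diagonal of the polygon.\<close>

lemma rot_tflip:
  assumes "rot t t'"
  shows "\<exists>e f. e \<noteq> {l, l + leaves t} \<and> tflip e f (tedges l t) (tedges l t')"
  using assms
proof (induction arbitrary: l rule: rot.induct)
  case (right a b c)
  show ?case
    using rot_tflip_base(1,3)[of l a b c] by (metis add.assoc leaves.simps(2))
next
  case (left a b c)
  show ?case
    using rot_tflip_base(2,4)[of l a b c] by (metis add.assoc leaves.simps(2))
next
  case (fst a a' b)
  let ?m = "l + leaves a"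
  obtain e f where ef: "tflip e f (tedges l a) (tedges l a')"
    using fst.IH by blast
  have e: "e \<in> tedges l a" using ef by (simp add: tflip_def)
  have "e \<notin> tedges ?m b" "e \<noteq> {l, ?m + leaves b}"
    using tedges_range[OF e] leaves_pos[of b]
    by (auto simp: doubleton_notin_tedges doubleton_eq_iff)
  then have "tflip e f (tedges l (Node a b)) (tedges l (Node a' b))"
    using tflip_Un[OF ef, of "insert {l, ?m + leaves b} (tedges ?m b)"] rot_leaves[OF fst.hyps]
    by simp
  moreover have "e \<noteq> {l, l + leaves (Node a b)}"
    using \<open>e \<noteq> {l, ?m + leaves b}\<close> by (simp add: add.assoc)
  ultimately show ?case by blast
next
  case (snd b b' a)
  let ?m = "l + leaves a"
  obtain e f where ef: "tflip e f (tedges ?m b) (tedges ?m b')"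
    using snd.IH by blast
  have e: "e \<in> tedges ?m b" using ef by (simp add: tflip_def)
  have "e \<notin> tedges l a" "e \<noteq> {l, ?m + leaves b}"
    using tedges_range[OF e] leaves_pos[of a]
    by (auto simp: doubleton_notin_tedges doubleton_eq_iff)
  then have "tflip e f (tedges l (Node a b)) (tedges l (Node a b'))"
    using tflip_Un[OF ef, of "insert {l, ?m + leaves b} (tedges l a)"] rot_leaves[OF snd.hyps]
    by (simp add: Un_commute)
  moreover have "e \<noteq> {l, l + leaves (Node a b)}"
    using \<open>e \<noteq> {l, ?m + leaves b}\<close> by (simp add: add.assoc)
  ultimately show ?case by blast
qed

subsection \<open>Centrally symmetric triangulations\<close>

text \<open>Here \<open>E\<close> is one half of a triangulation and \<open>h\<close> the half turn.
  The assumptions ensure that deleting \<open>e\<close> and \<open>h e\<close> from the union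
  removes only \<open>e\<close> from \<open>E\<close> and only \<open>h e\<close> from its
  image.\<close>

lemma exchange_image_Un:
  assumes "e \<in> E" "e \<notin> h ` E" "h e \<notin> E" "inj_on h E"
  shows "(E - {e} \<union> {f}) \<union> h ` (E - {e} \<union> {f}) = (E \<union> h ` E) - {e, h e} \<union> {f, h f}"
  using assms by (auto simp: inj_on_def)

text \<open>The last assumption excludes the side \<open>{0, 2 * d + 1}\<close>, whose indices are
  not consecutive.\<close>

lemma not_boundary_edge:
  assumes "Suc x < x'" "x' < 2 * d + 2" "0 < x \<or> x' < 2 * d + 1"
  shows "{x, x'} \<notin> boundary_edges (2 * d + 2)"
proof
  assume "{x, x'} \<in> boundary_edges (2 * d + 2)"
  then obtain i where i: "i < 2 * d + 2" "{x, x'} = {i, Suc i mod (2 * d + 2)}"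
    by (auto simp: boundary_edges_def)
  show False
  proof (cases "Suc i < 2 * d + 2")
    case True
    then show False using i(2) assms(1) by (auto simp: doubleton_eq_iff)
  next
    case False
    then have "Suc i = 2 * d + 2" using i(1) by simp
    then have "i = 2 * d + 1" "Suc i mod (2 * d + 2) = 0" by simp_all
    then show False using i(2) assms by (auto simp: doubleton_eq_iff)
  qed
qed

text \<open>
  The tree \<open>t\<close> describes the triangulation on one side \<open>{l..l + d + 1}\<close> of the diagonal.
\<close>

definition cs_of :: "nat \<Rightarrow> nat \<Rightarrow> tree \<Rightarrow> nat set set" where
  "cs_of d l t = tedges l t \<union> (`) (opposite d) ` tedges l t"

locale cs_polygon =
  fixes d :: nat and p :: "nat \<Rightarrow> real ^ 2"
  assumes polygon: "convex_polygon (2 * d + 2) p"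
begin

lemma tedges_edges_on:
  assumes "l + leaves t \<le> 2 * d + 1"
  shows "tedges l t \<subseteq> edges_on (2 * d + 2)"
proof
  fix e assume "e \<in> tedges l t"
  then obtain x y where "e = {x, y}" "x < y" "y \<le> l + leaves t"
    using tedges_range by blast
  with assms show "e \<in> edges_on (2 * d + 2)" by (simp add: edges_onI)
qed

lemma tedges_not_crossing:
  assumes "e \<in> tedges l t" "f \<in> tedges l t" "l + leaves t \<le> 2 * d + 1"
  shows "\<not> crossing p e f"
proof -
  obtain x x' where e: "e = {x, x'}" "x < x'" "x' \<le> l + leaves t"
    using tedges_range[OF assms(1)] by blast
  obtain y y' where f: "f = {y, y'}" "y < y'" "y' \<le> l + leaves t"
    using tedges_range[OF assms(2)] by blast
  have "\<not> interleaved x x' y y'"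
    using tedges_not_interleaved assms(1,2) e f by blast
  then show ?thesis
    using crossing_iff[OF polygon, of x x' y y'] e f assms(3) by simp
qed

lemma opposite_half:
  assumes "l \<le> d" "l \<le> z" "z \<le> l + d + 1"
  shows "opposite d z \<le> l \<or> l + d + 1 \<le> opposite d z"
  using assms by (cases "z \<le> d") (auto simp: opposite_le opposite_gt)

lemma opposite_other_half:
  assumes "l \<le> d" "z \<le> l \<or> l + d + 1 \<le> z" "z < 2 * d + 2"
  shows "l \<le> opposite d z \<and> opposite d z \<le> l + d + 1"
  using assms by (cases "z \<le> d") (auto simp: opposite_le opposite_gt)

context
  fixes l t
  assumes l: "l \<le> d" and t: "leaves t = d + 1"
begin

lemma half_edges_on: "tedges l t \<subseteq> edges_on (2 * d + 2)"
  using l t by (intro tedges_edges_on) simp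

lemma cs_of_edges_on: "cs_of d l t \<subseteq> edges_on (2 * d + 2)"
  using half_edges_on edges_on_opposite by (auto simp: cs_of_def)

lemma cs_of_opposite:
  assumes "e \<in> cs_of d l t"
  shows "opposite d ` e \<in> cs_of d l t"
proof (cases "e \<in> tedges l t")
  case True
  then show ?thesis by (simp add: cs_of_def)
next
  case False
  then obtain g where g: "g \<in> tedges l t" "e = opposite d ` g"
    using assms by (auto simp: cs_of_def)
  then have "opposite d ` e = g"
    using opposite_opposite_image half_edges_on by blast
  then show ?thesis using g(1) by (simp add: cs_of_def)
qed

lemma half_not_crossing_other_half:
  assumes "e \<in> tedges l t" "g \<in> tedges l t"
  shows "\<not> crossing p e (opposite d ` g)"
proof -
  have "opposite d ` g \<in> edges_on (2 * d + 2)"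
    using assms half_edges_on edges_on_opposite by blast
  then obtain u v where uv: "opposite d ` g = {u, v}" "u < v" "v < 2 * d + 2"
    by (rule edges_on_cases)
  have outer: "z \<le> l \<or> l + d + 1 \<le> z" if "z \<in> opposite d ` g" for z
    using that tedges_mem_le[OF assms(2)] opposite_half[OF l] t by force
  obtain x x' where e: "e = {x, x'}" "l \<le> x" "x < x'" "x' \<le> l + leaves t"
    using tedges_range[OF assms(1)] by blast
  have "\<not> interleaved x x' u v"
    using outer[of u] outer[of v] e t uv unfolding interleaved_def by auto
  then show ?thesis
    using crossing_iff[OF polygon, of x x' u v] e uv l t by simp
qed

text \<open>If \<open>e\<close> lies on the far side, the half turn is applied to both edges, which
  brings \<open>e\<close> to the side of the tree.\<close>

lemma cs_of_not_crossing:
  assumes "e \<in> cs_of d l t" "f \<in> cs_of d l t"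
  shows "\<not> crossing p e f"
proof -
  have half: "\<not> crossing p e f" if "e \<in> tedges l t" "f \<in> cs_of d l t" for e f
    using that half_not_crossing_other_half[of e] tedges_not_crossing[of e l t f] l t
    by (auto simp: cs_of_def)
  show ?thesis
  proof (cases "e \<in> tedges l t")
    case False
    then obtain g where g: "g \<in> tedges l t" "e = opposite d ` g"
      using assms(1) by (auto simp: cs_of_def)
    then have "opposite d ` e = g"
      using opposite_opposite_image half_edges_on by blast
    then show ?thesis
      using half[OF g(1) cs_of_opposite[OF assms(2)]] crossing_opposite[OF polygon, of e f]
        assms cs_of_edges_on by auto
  qed (use half assms in blast)
qed

lemma half_maximal:
  assumes "e \<in> edges_on (2 * d + 2)" "e \<notin> tedges l t" "\<And>z. z \<in> e \<Longrightarrow> l \<le> z \<and> z \<le> l + d + 1"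
  shows "\<exists>f\<in>tedges l t. crossing p e f"
proof -
  obtain x y where e: "e = {x, y}" "x < y" "y < 2 * d + 2"
    using assms(1) by (rule edges_on_cases)
  have "l \<le> x" "y \<le> l + leaves t"
    using assms(3) e(1) t by auto
  then obtain u v where uv: "{u, v} \<in> tedges l t" "u < v" "interleaved x y u v"
    using tedges_maximal[of l x y t] e assms(2) by auto
  then have "v < 2 * d + 2"
    using tedges_mem_le[OF uv(1), of v] l t by simp
  then show ?thesis
    using crossing_iff[OF polygon, of x y u v] e uv by blast
qed

text \<open>An edge lies on the side of the tree, lies on the other side, or crosses the diagonal,
  which is the root edge. The second case becomes the first one after a half turn.\<close>

lemma cs_of_maximal:
  assumes e: "e \<in> edges_on (2 * d + 2)" "e \<notin> cs_of d l t"
  shows "\<exists>f\<in>cs_of d l t. crossing p e f"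
proof -
  obtain x y where xy: "e = {x, y}" "x < y" "y < 2 * d + 2"
    using e(1) by (rule edges_on_cases)
  consider "l \<le> x" "y \<le> l + d + 1"
    | "x \<le> l \<or> l + d + 1 \<le> x" "y \<le> l \<or> l + d + 1 \<le> y"
    | "interleaved x y l (l + d + 1)"
    unfolding interleaved_def using xy(2) by linarith
  then show ?thesis
  proof cases
    case 1
    then have "\<exists>f\<in>tedges l t. crossing p e f"
      using e xy by (intro half_maximal) (auto simp: cs_of_def)
    then show ?thesis by (auto simp: cs_of_def)
  next
    case 2
    let ?e = "opposite d ` e"
    have ee: "opposite d ` ?e = e" using e(1) by (rule opposite_opposite_image)
    have e': "?e \<in> edges_on (2 * d + 2)" using e(1) by (rule edges_on_opposite)
    have "?e \<notin> tedges l t"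
      using ee e(2) unfolding cs_of_def by (metis UnCI imageI)
    moreover have "l \<le> z \<and> z \<le> l + d + 1" if "z \<in> ?e" for z
      using that 2 xy opposite_other_half[OF l] by auto
    ultimately obtain f where f: "f \<in> tedges l t" "crossing p ?e f"
      using half_maximal[OF e'] by blast
    then have "crossing p e (opposite d ` f)"
      using crossing_opposite[OF polygon e', of f] half_edges_on ee by auto
    then show ?thesis using f(1) by (auto simp: cs_of_def)
  next
    case 3
    then have "crossing p e {l, l + d + 1}"
      using crossing_iff[OF polygon, of x y l "l + d + 1"] xy l by auto
    moreover have "{l, l + d + 1} \<in> cs_of d l t"
      using tedges_root[of l t] t by (simp add: cs_of_def)
    ultimately show ?thesis by blast
  qed
qed

lemma cs_of_cs_triangulation: "cs_triangulation d p (cs_of d l t)"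
  unfolding cs_triangulation_def triangulation_def
proof (intro conjI allI impI)
  show "non_crossing p (cs_of d l t)"
    using cs_of_not_crossing by (auto simp: non_crossing_def pairwise_def)
  show "T' = cs_of d l t"
    if T': "T' \<subseteq> edges_on (2 * d + 2)" "non_crossing p T'" "cs_of d l t \<subseteq> T'" for T'
  proof (rule ccontr)
    assume "T' \<noteq> cs_of d l t"
    then obtain e where e: "e \<in> T'" "e \<notin> cs_of d l t" using T'(3) by blast
    have "e \<in> edges_on (2 * d + 2)" using e(1) T'(1) by blast
    from cs_of_maximal[OF this e(2)] obtain f where "f \<in> cs_of d l t" "crossing p e f" ..
    moreover from this have "f \<in> T'" "e \<noteq> f" using T'(3) e(2) by auto
    ultimately show False
      using T'(2) e(1) unfolding non_crossing_def pairwise_def by blast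
  qed
  show "{opposite d x, opposite d y} \<in> cs_of d l t" if "{x, y} \<in> cs_of d l t" for x y
    using cs_of_opposite[OF that] by simp
qed (rule cs_of_edges_on)

lemma root_if_in_both_halves:
  assumes "e \<in> tedges l t" "g \<in> tedges l t" "e = opposite d ` g"
  shows "e = {l, l + d + 1}"
proof -
  obtain x y where e: "e = {x, y}" "l \<le> x" "x < y" "y \<le> l + d + 1"
    using tedges_range[OF assms(1)] t by auto
  have "z \<le> l \<or> l + d + 1 \<le> z" if "z \<in> e" for z
    using that assms(3) tedges_mem_le[OF assms(2)] opposite_half[OF l] t by force
  from this[of x] this[of y] e show ?thesis by auto
qed

text \<open>Since \<open>e\<close> is not the diagonal, \<open>e\<close> and its image each belong
  to only one half. One exchange in the tree together with its symmetric copy is thus a single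
  flip.\<close>

lemma tflip_flip:
  assumes t': "leaves t' = d + 1" and flip: "tflip e f (tedges l t) (tedges l t')"
    and root: "e \<noteq> {l, l + d + 1}"
  shows "flip d p (cs_of d l t) (cs_of d l t')"
proof -
  let ?E = "tedges l t" and ?o = "(`) (opposite d)"
  note tf = flip[unfolded tflip_def]
  have e: "e \<in> ?E" by (rule tf[THEN conjunct1])
  have E': "tedges l t' = ?E - {e} \<union> {f}" by (rule tf[THEN conjunct2, THEN conjunct1])
  obtain x x' y y' where xy: "e = {x, x'}" "f = {y, y'}" "Suc x < x'" "y < y'"
     "interleaved x x' y y'" "{x, y} \<in> ?E" "{y, x'} \<in> ?E" "{x', y'} \<in> ?E" "{y', x} \<in> ?E"
    using tf[THEN conjunct2, THEN conjunct2] by (elim exE conjE) (rule that)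
  have rng: "l \<le> x" "x' \<le> l + d + 1" "y' \<le> l + d + 1"
    using tedges_mem_le[OF e] tedges_mem_le[OF xy(8)] xy(1) t by auto
  have inv: "?o (?o g) = g" if "g \<in> ?E" for g
    using that half_edges_on opposite_opposite_image by blast
  have e1: "e \<notin> ?o ` ?E"
    using root_if_in_both_halves[OF e] root by blast
  have e2: "?o e \<notin> ?E"
    using e1 inv[OF e] by (metis imageI)
  have "inj_on ?o ?E"
    using inv by (rule inj_on_inverseI)
  then have "cs_of d l t' = cs_of d l t - {e, ?o e} \<union> {f, ?o f}"
    unfolding cs_of_def E' using e e1 e2 by (intro exchange_image_Un)
  moreover have "crossing p {x, x'} {y, y'}"
    using crossing_iff[OF polygon, of x x' y y'] xy rng l by simp
  moreover have "{x, x'} \<notin> boundary_edges (2 * d + 2)"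
    using xy(3) rng l by (intro not_boundary_edge) auto
  ultimately show ?thesis
    unfolding flip_def using cs_of_cs_triangulation e xy
    by (intro conjI exI[of _ x] exI[of _ x'] exI[of _ y] exI[of _ y']) (simp_all add: cs_of_def)
qed

end

lemma rot_flip:
  assumes "l \<le> d" "leaves t = d + 1" "rot t t'"
  shows "flip d p (cs_of d l t) (cs_of d l t')"
proof -
  obtain e f where "e \<noteq> {l, l + leaves t}" "tflip e f (tedges l t) (tedges l t')"
    using rot_tflip[OF assms(3)] by blast
  then show ?thesis
    using assms rot_leaves[OF assms(3)] by (intro tflip_flip[of l t t' e f]) auto
qed

lemma reach_rot_flip:
  assumes "l \<le> d" "leaves t = d + 1" "reach rot k t t'"
  shows "reach (flip d p) k (cs_of d l t) (cs_of d l t')"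
  by (rule reach_map[where P = "\<lambda>t. leaves t = d + 1" and r = rot and s = "flip d p" and f = "cs_of d l"])
    (use assms rot_flip rot_leaves in auto)

section \<open>Flipping the diagonal\<close>

text \<open>\<open>a\<close>, \<open>b\<close>, \<open>a'\<close>, \<open>b'\<close> are the corners
  of the centrally symmetric quadrilateral in which one diagonal replaces the other. Copies of
  \<open>B\<close>, \<open>A\<close>, \<open>B\<close>, \<open>A\<close> lie over its four sides in
  this order, so the half starting at \<open>b\<close> reads \<open>Node A B\<close> and the half
  starting at \<open>a\<close> reads \<open>Node B A\<close>.\<close>

lemma flip_diagonal:
  assumes a: "leaves B + a \<le> d" and AB: "leaves A + leaves B = d + 1"
  defines "b \<equiv> a + leaves B"
  shows "flip d p (cs_of d b (Node A B)) (cs_of d a (Node B A))"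
    and "flip d p (cs_of d a (Node B A)) (cs_of d b (Node A B))"
proof -
  let ?o = "(`) (opposite d)"
  define a' b' where "a' = a + d + 1" and "b' = b + d + 1"
  note pos = leaves_pos[of A] leaves_pos[of B]
  have b: "b \<le> d" "a < b" "b < a'" using a AB pos by (auto simp: b_def a'_def)
  have ab: "b + leaves A = a'" "a' + leaves B = b'" using AB by (auto simp: b_def a'_def b'_def)
  have opp: "opposite d a = a'" "opposite d b = b'" "opposite d a' = a" "opposite d b' = b"
    using b by (auto simp: opposite_le opposite_gt a'_def b'_def)
  \<comment> \<open>The edges common to both triangulations. The arc from \<open>b'\<close> to
    \<open>a\<close> wraps around to vertex 0, so the copy of \<open>A\<close> there is written as
    an image.\<close>
  define C where "C = tedges b A \<union> ?o ` tedges b A \<union> tedges a B \<union> tedges a' B"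
  have o1: "?o ` tedges a B = tedges a' B"
  proof -
    have "?o e = (\<lambda>x. x + (d + 1)) ` e" if "e \<in> tedges a B" for e
    proof (intro image_cong refl)
      fix x assume "x \<in> e"
      then have "x \<le> d" using tedges_mem_le[OF that] b by (fastforce simp: b_def)
      then show "opposite d x = x + (d + 1)" by (simp add: opposite_le)
    qed
    then have "?o ` tedges a B = (`) (\<lambda>x. x + (d + 1)) ` tedges a B"
      by (rule image_cong[OF refl])
    then show ?thesis using tedges_shift[of "d + 1" a B] by (simp add: a'_def add.assoc)
  qed
  have "?o (?o e) = e" if "e \<in> tedges a B" for e
    using tedges_edges_on[of a B] that b b_def by (intro opposite_opposite_image) auto
  then have o2: "?o ` tedges a' B = tedges a B"
    unfolding o1[symmetric] by (simp add: image_image)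
  have un: "insert e (E \<union> F) \<union> insert e (G \<union> H) = insert e (E \<union> G \<union> H \<union> F)"
    "insert e (E \<union> F) \<union> insert e (G \<union> H) = insert e (F \<union> H \<union> E \<union> G)"
    for e and E F G H :: "nat set set"
    by blast+
  have img: "?o ` insert e (E \<union> F) = insert (?o e) (?o ` E \<union> ?o ` F)" for e E F
    by (simp add: image_Un)
  have exchange: "insert f E = insert e E - {e, e} \<union> {f, f}" if "e \<notin> E" for e f and E :: "nat set set"
    using that by blast
  have fixed: "opposite d ` {b, b'} = {b, b'}" "opposite d ` {a, a'} = {a, a'}"
    by (simp_all add: opp insert_commute)
  have "tedges b (Node A B) = insert {b, b'} (tedges b A \<union> tedges a' B)"
    by (simp add: ab)
  then have eqb: "cs_of d b (Node A B) = insert {b, b'} C"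
    unfolding cs_of_def C_def by (simp only: img fixed o2) (rule un(1))
  have "tedges a (Node B A) = insert {a, a'} (tedges a B \<union> tedges b A)"
    by (simp only: tedges.simps b_def[symmetric] ab)
  then have eqa: "cs_of d a (Node B A) = insert {a, a'} C"
    unfolding cs_of_def C_def by (simp only: img fixed o1) (rule un(2))
  have la: "leaves (Node B A) = d + 1" "leaves (Node A B) = d + 1" using AB by auto
  have ad: "a \<le> d" using a by simp
  have cr: "crossing p {a, a'} {b, b'}"
    using crossing_iff[OF polygon, of a a' b b'] b by (simp add: interleaved_def a'_def b'_def)
  \<comment> \<open>The two diagonals cross each other, whereas \<open>C\<close> together with
    either of them is free of crossings.\<close>
  have notin: "{a, a'} \<notin> C" "{b, b'} \<notin> C"
    using cs_of_not_crossing[OF ad la(1), of "{a, a'}" "{b, b'}"]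
      cs_of_not_crossing[OF b(1) la(2), of "{a, a'}" "{b, b'}"] cr eqa eqb by auto
  have C1: "{a, b} \<in> C" "{b, a'} \<in> C" "{a', b'} \<in> C"
    using tedges_root[of a B] tedges_root[of b A] tedges_root[of a' B] ab b_def
    by (auto simp: C_def)
  have "{b, a'} \<in> tedges b A" using tedges_root[of b A] by (simp only: ab)
  then have "?o {b, a'} \<in> C" unfolding C_def Un_iff by blast
  then have C2: "{b', a} \<in> C" using opp by simp
  have C: "{a, b} \<in> C" "{b, a'} \<in> C" "{a', b'} \<in> C" "{b', a} \<in> C"
    "{b, a} \<in> C" "{a', b} \<in> C" "{b', a'} \<in> C" "{a, b'} \<in> C"
    using C1 C2 by (simp_all add: insert_commute)
  have bd: "{a, a'} \<notin> boundary_edges (2 * d + 2)" "{b, b'} \<notin> boundary_edges (2 * d + 2)"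
    by (rule not_boundary_edge; use b in \<open>auto simp: a'_def b'_def\<close>)+
  show "flip d p (cs_of d b (Node A B)) (cs_of d a (Node B A))"
    unfolding flip_def
  proof (intro conjI exI)
    show "cs_of d a (Node B A) = cs_of d b (Node A B) - {{b, b'}, {opposite d b, opposite d b'}}
        \<union> {{a, a'}, {opposite d a, opposite d a'}}"
      unfolding eqa eqb opp insert_commute[of a' a] insert_commute[of b' b] by (rule exchange[OF notin(2)])
    show "cs_triangulation d p (cs_of d b (Node A B))"
      by (rule cs_of_cs_triangulation[OF b(1) la(2)])
    show "crossing p {b, b'} {a, a'}" using cr by (rule crossing_sym)
  qed (use C bd in \<open>auto simp: eqb\<close>)
  show "flip d p (cs_of d a (Node B A)) (cs_of d b (Node A B))"
    unfolding flip_def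
  proof (intro conjI exI)
    show "cs_of d b (Node A B) = cs_of d a (Node B A) - {{a, a'}, {opposite d a, opposite d a'}}
        \<union> {{b, b'}, {opposite d b, opposite d b'}}"
      unfolding eqa eqb opp insert_commute[of a' a] insert_commute[of b' b] by (rule exchange[OF notin(1)])
    show "cs_triangulation d p (cs_of d a (Node B A))"
      by (rule cs_of_cs_triangulation[OF ad la(1)])
    show "crossing p {a, a'} {b, b'}" by (rule cr)
  qed (use C bd in \<open>auto simp: eqa\<close>)
qed

subsection \<open>Every centrally symmetric triangulation comes from a tree\<close>

lemma triangulation_not_interleaved:
  assumes T: "triangulation (2 * d + 2) p T" and "{x, x'} \<in> T" "{y, y'} \<in> T"
    and "x < x'" "x' < 2 * d + 2" "y < y'" "y' < 2 * d + 2"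
  shows "\<not> interleaved x x' y y'"
proof
  assume int: "interleaved x x' y y'"
  then have "crossing p {x, x'} {y, y'}"
    using crossing_iff[OF polygon] assms by simp
  moreover have "{x, x'} \<noteq> {y, y'}"
    using int by (auto simp: interleaved_def doubleton_eq_iff)
  ultimately show False
    using T pairwiseD[of _ T "{x, x'}" "{y, y'}"] assms(2,3)
    by (auto simp: triangulation_def non_crossing_def)
qed

lemma triangulation_memI:
  assumes T: "triangulation (2 * d + 2) p T" and xy: "x < y" "y < 2 * d + 2"
    and free: "\<And>u v. {u, v} \<in> T \<Longrightarrow> u < v \<Longrightarrow> v < 2 * d + 2 \<Longrightarrow> \<not> interleaved x y u v"
  shows "{x, y} \<in> T"
proof -
  have sub: "T \<subseteq> edges_on (2 * d + 2)" using T by (simp add: triangulation_def)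
  have nc: "\<not> crossing p {x, y} f" if "f \<in> T" for f
  proof -
    have "f \<in> edges_on (2 * d + 2)" using that sub by blast
    then obtain u v where uv: "f = {u, v}" "u < v" "v < 2 * d + 2" by (rule edges_on_cases)
    then show ?thesis
      using crossing_iff[OF polygon xy uv(2,3)] free that by blast
  qed
  have "non_crossing p (insert {x, y} T)"
    using T nc crossing_sym[of p _ "{x, y}"]
    by (auto simp: triangulation_def non_crossing_def pairwise_insert)
  moreover have "insert {x, y} T \<subseteq> edges_on (2 * d + 2)"
    using sub edges_onI[OF xy] by simp
  ultimately have "insert {x, y} T = T"
    using T subset_insertI[of T "{x, y}"] unfolding triangulation_def by meson
  then show ?thesis by blast
qed

text \<open>The apex is the largest neighbour \<open>j\<close> of \<open>i\<close> strictly between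
  \<open>i\<close> and \<open>k\<close>. An edge crossing \<open>{j, k}\<close> but neither
  \<open>{i, k}\<close> nor \<open>{i, j}\<close> would join \<open>i\<close> to a vertex between
  \<open>j\<close> and \<open>k\<close>, against the choice of \<open>j\<close>.\<close>

lemma triangulation_apex:
  assumes T: "triangulation (2 * d + 2) p T"
    and ik: "{i, k} \<in> T" "Suc i < k" "k < 2 * d + 2"
  obtains j where "i < j" "j < k" "{i, j} \<in> T" "{j, k} \<in> T"
proof -
  define J where "J = {j. i < j \<and> j < k \<and> {i, j} \<in> T}"
  have fin: "finite J" by (rule finite_subset[of _ "{..<k}"]) (auto simp: J_def)
  have "{i, Suc i} \<in> T"
    using ik by (intro triangulation_memI[OF T]) (auto simp: interleaved_def)
  then have "J \<noteq> {}" using ik by (auto simp: J_def)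
  define j where "j = Max J"
  have j: "i < j" "j < k" "{i, j} \<in> T"
    using Max_in[OF fin \<open>J \<noteq> {}\<close>] by (auto simp: j_def J_def)
  have max: "j' \<le> j" if "i < j'" "j' < k" "{i, j'} \<in> T" for j'
    using Max_ge[OF fin, of j'] that by (simp add: j_def J_def)
  have "{j, k} \<in> T"
  proof (rule triangulation_memI[OF T])
    fix u v assume uv: "{u, v} \<in> T" "u < v" "v < 2 * d + 2"
    have ik': "\<not> interleaved i k u v" and ij': "\<not> interleaved i j u v"
      using triangulation_not_interleaved[OF T ik(1) uv(1)]
        triangulation_not_interleaved[OF T j(3) uv(1)] ik uv j by auto
    show "\<not> interleaved j k u v"
    proof
      assume "interleaved j k u v"
      with ik' ij' j have "u = i" "j < v" "v < k"
        unfolding interleaved_def by linarith+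
      with max[of v] uv j show False by simp
    qed
  qed (use j ik in auto)
  with j show ?thesis by (rule that)
qed

lemma exists_tree:
  assumes T: "triangulation (2 * d + 2) p T"
    and "{i, k} \<in> T" "i < k" "k < 2 * d + 2"
  shows "\<exists>t. leaves t = k - i \<and> tedges i t \<subseteq> T"
  using assms(2-)
proof (induction "k - i" arbitrary: i k rule: less_induct)
  case less
  show ?case
  proof (cases "k = Suc i")
    case True
    then show ?thesis using less.prems by (intro exI[of _ Leaf]) simp
  next
    case False
    then obtain j where j: "i < j" "j < k" "{i, j} \<in> T" "{j, k} \<in> T"
      using triangulation_apex[OF T] less.prems by (metis Suc_lessI)
    have smaller: "j - i < k - i" "k - j < k - i" and "j < 2 * d + 2"
      using j less.prems by linarith+
    obtain a where a: "leaves a = j - i" "tedges i a \<subseteq> T"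
      using less.hyps[OF smaller(1) j(3,1) \<open>j < 2 * d + 2\<close>] by blast
    obtain b where "leaves b = k - j" "tedges j b \<subseteq> T"
      using less.hyps[OF smaller(2) j(4,2) less.prems(3)] by blast
    with a j less.prems show ?thesis
      by (intro exI[of _ "Node a b"]) simp
  qed
qed

text \<open>Among the edges whose indices differ by at least \<open>d + 1\<close>, one with least
  difference \<open>m\<close> is taken. If \<open>m > d + 1\<close>, the two other edges of the
  triangle below it have difference at most \<open>d\<close>, and the half-turn image of the chosen
  edge crosses one of them, \<open>{i, j}\<close>.\<close>

lemma exists_diagonal:
  assumes T: "cs_triangulation d p T"
  shows "\<exists>l\<le>d. {l, l + d + 1} \<in> T"
proof -
  have tri: "triangulation (2 * d + 2) p T" using T by (simp add: cs_triangulation_def)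
  let ?P = "\<lambda>m. \<exists>i. i + m < 2 * d + 2 \<and> {i, i + m} \<in> T \<and> d + 1 \<le> m"
  have "{0, 2 * d + 1} \<in> T"
    by (rule triangulation_memI[OF tri]) (auto simp: interleaved_def)
  then have "?P (2 * d + 1)" by (intro exI[of _ 0]) simp
  then have "?P (LEAST m. ?P m)" by (rule LeastI)
  then obtain m i where m: "m = (LEAST m. ?P m)" "i + m < 2 * d + 2" "{i, i + m} \<in> T" "d + 1 \<le> m"
    by blast
  have "m = d + 1"
  proof (rule ccontr)
    assume "m \<noteq> d + 1"
    then have long: "d + 1 < m" using m(4) by simp
    then obtain j where j: "i < j" "j < i + m" "{i, j} \<in> T" "{j, i + m} \<in> T"
      using triangulation_apex[OF tri m(3)] m(2) by auto
    have small: "m' \<le> d" if "i' + m' < 2 * d + 2" "{i', i' + m'} \<in> T" "m' < m" for i' m'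
      using not_less_Least[of m' ?P] m(1) that by fastforce
    have "j - i \<le> d" "i + m - j \<le> d"
      using small[of i "j - i"] small[of j "i + m - j"] j m(2) by auto
    then have "interleaved i j (i + m - (d + 1)) (i + d + 1)"
      using j long by (auto simp: interleaved_def)
    moreover have "{opposite d i, opposite d (i + m)} \<in> T"
      using T m(3) by (simp add: cs_triangulation_def)
    then have "{i + m - (d + 1), i + d + 1} \<in> T"
      using long m(2) by (simp add: opposite_le opposite_gt insert_commute)
    moreover have "i + m - (d + 1) < i + d + 1" "i + d + 1 < 2 * d + 2" "j < 2 * d + 2"
      using j long m(2) by linarith+
    ultimately show False
      using triangulation_not_interleaved[OF tri j(3), of "i + m - (d + 1)" "i + d + 1"] j(1)
      by blast
  qed
  then show ?thesis using m by (intro exI[of _ i]) (simp add: add.assoc)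
qed

text \<open>The tree on one side of a diagonal and its half-turn image form a triangulation
  contained in \<open>T\<close>; being maximal, it equals \<open>T\<close>.\<close>

lemma cs_triangulation_cs_of:
  assumes T: "cs_triangulation d p T"
  obtains l t where "l \<le> d" "leaves t = d + 1" "T = cs_of d l t"
proof -
  have tri: "triangulation (2 * d + 2) p T" using T by (simp add: cs_triangulation_def)
  obtain l where l: "l \<le> d" "{l, l + d + 1} \<in> T"
    using exists_diagonal[OF T] by blast
  then obtain t where t: "leaves t = d + 1" "tedges l t \<subseteq> T"
    using exists_tree[OF tri, of l "l + d + 1"] by auto
  have "opposite d ` e \<in> T" if e: "e \<in> tedges l t" for e
  proof -
    obtain x y where "e = {x, y}" using tedges_range[OF e] by blast
    then show ?thesis using e t(2) T by (auto simp: cs_triangulation_def)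
  qed
  then have "cs_of d l t \<subseteq> T"
    using t(2) by (auto simp: cs_of_def)
  then have "T = cs_of d l t"
    using cs_of_cs_triangulation[OF l(1) t(1)] tri
    unfolding cs_triangulation_def triangulation_def by metis
  then show ?thesis using that l(1) t(1) by blast
qed

section \<open>Counting flips\<close>

lemma flip_distance_le:
  assumes "reach (flip d p) k T T'"
  shows "flip_distance d p T T' \<le> enat k"
proof -
  obtain j where "j \<le> k" "(flip d p ^^ j) T T'"
    using assms by (auto simp: reach_def)
  then show ?thesis
    unfolding flip_distance_def by (intro INF_lower2[of j]) auto
qed

text \<open>\<open>X\<close> is the fan at the first or at the last vertex of the half, and its
  choice depends on \<open>v\<close> and \<open>w\<close> but not on \<open>t\<close>. Only the
  smaller of the two combs has to be absorbed; as \<open>v + w = d + 1\<close>, this takes at most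
  \<open>(d - 1) div 2\<close> rotations.\<close>

lemma reach_combs:
  assumes "v + w = d + 1" "0 < v" "0 < w"
  obtains X where "leaves X = d + 1" "\<And>t. leaves t = d + 1 \<Longrightarrow> reach rot (d - 1) t X"
    "reach rot ((d - 1) div 2) (Node (lcomb (w - 1)) (rcomb (v - 1))) X"
proof (cases "v \<le> w")
  case True
  have "w - 1 + leaves (rcomb (v - 1)) = d" "leaves (rcomb (v - 1)) - 1 \<le> (d - 1) div 2"
    using assms True by (auto simp: leaves_comb)
  then have "reach rot ((d - 1) div 2) (Node (lcomb (w - 1)) (rcomb (v - 1))) (lcomb d)"
    using reach_lcomb_append reach_mono by metis
  moreover have "reach rot (d - 1) t (lcomb d)" if "leaves t = d + 1" for t
    using reach_lcomb[of t] that by simp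
  ultimately show ?thesis by (intro that[of "lcomb d"]) (auto simp: leaves_comb)
next
  case False
  have "v - 1 + leaves (lcomb (w - 1)) = d" "leaves (lcomb (w - 1)) - 1 \<le> (d - 1) div 2"
    using assms False by (auto simp: leaves_comb)
  then have "reach rot ((d - 1) div 2) (Node (lcomb (w - 1)) (rcomb (v - 1))) (rcomb d)"
    using reach_rcomb_append reach_mono by metis
  moreover have "reach rot (d - 1) t (rcomb d)" if "leaves t = d + 1" for t
    using reach_rcomb[of t] that by simp
  ultimately show ?thesis by (intro that[of "rcomb d"]) (auto simp: leaves_comb)
qed

lemma reach_cs_of_less:
  assumes "l1 < l2" "l2 \<le> d" "leaves t1 = d + 1" "leaves t2 = d + 1"
  defines "k \<equiv> 2 * d - 1 + (d - 1) div 2"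
  shows "reach (flip d p) k (cs_of d l1 t1) (cs_of d l2 t2)"
    and "reach (flip d p) k (cs_of d l2 t2) (cs_of d l1 t1)"
proof -
  \<comment> \<open>\<open>w\<close> is the offset between the two diagonals, and \<open>v\<close>
    is the position of the vertex \<open>l1 + d + 1\<close> counted from \<open>l2\<close>; the fan
    made from \<open>t2\<close> is placed there.\<close>
  define w v where "w = l2 - l1" and "v = d + 1 - w"
  have vw: "v + w = d + 1" "0 < v" "0 < w" "l2 = l1 + w"
    using assms by (auto simp: v_def w_def)
  define L R where "L = lcomb (w - 1)" and "R = rcomb (v - 1)"
  have LR: "leaves L = w" "leaves R = v"
    using vw by (auto simp: L_def R_def leaves_comb)
  obtain X where X: "leaves X = d + 1" "\<And>t. leaves t = d + 1 \<Longrightarrow> reach rot (d - 1) t X"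
    "reach rot ((d - 1) div 2) (Node L R) X"
    using reach_combs[OF vw(1-3)] unfolding L_def R_def by blast
  have "leaves t2 - v - 1 = w - 1" "leaves t2 - 2 = d - 1" using assms(4) vw by auto
  then have fan: "reach rot (d - 1) t2 (Node R L)"
    using reach_fan[of v t2] vw assms(4) by (simp add: L_def R_def)
  have half: "reach rot (d - 1 + (d - 1) div 2) t1 (Node L R)"
    by (rule reach_trans[OF X(2)[OF assms(3)] reach_sym[OF X(3) rot_sym]])
  have l1: "l1 \<le> d" using assms by simp
  have RL: "leaves R + leaves L = d + 1" "leaves L + l1 \<le> d" "l2 = l1 + leaves L"
    using LR vw assms by auto
  have lv: "leaves (Node L R) = d + 1" "leaves (Node R L) = d + 1" using LR vw by auto
  have diag: "reach (flip d p) (Suc 0) (cs_of d l1 (Node L R)) (cs_of d l2 (Node R L))"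
    "reach (flip d p) (Suc 0) (cs_of d l2 (Node R L)) (cs_of d l1 (Node L R))"
    using flip_diagonal[OF RL(2,1)] by (auto simp: RL(3) intro: reach_step)
  have le: "d - 1 + (d - 1) div 2 + Suc 0 + (d - 1) \<le> k" "d - 1 + Suc 0 + (d - 1 + (d - 1) div 2) \<le> k"
    using vw by (auto simp: k_def)
  show "reach (flip d p) k (cs_of d l1 t1) (cs_of d l2 t2)"
    by (rule reach_mono[OF reach_trans[OF reach_trans[OF
          reach_rot_flip[OF l1 assms(3) half] diag(1)]
          reach_rot_flip[OF assms(2) lv(2) reach_sym[OF fan rot_sym]]] le(1)])
  show "reach (flip d p) k (cs_of d l2 t2) (cs_of d l1 t1)"
    by (rule reach_mono[OF reach_trans[OF reach_trans[OF
          reach_rot_flip[OF assms(2,4) fan] diag(2)]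
          reach_rot_flip[OF l1 lv(1) reach_sym[OF half rot_sym]]] le(2)])
qed

lemma reach_cs_triangulations:
  assumes "0 < d" "cs_triangulation d p T" "cs_triangulation d p T'"
  shows "reach (flip d p) (2 * d - 1 + (d - 1) div 2) T T'"
proof -
  obtain l t where T: "l \<le> d" "leaves t = d + 1" "T = cs_of d l t"
    using assms(2) by (rule cs_triangulation_cs_of)
  obtain l' t' where T': "l' \<le> d" "leaves t' = d + 1" "T' = cs_of d l' t'"
    using assms(3) by (rule cs_triangulation_cs_of)
  consider "l < l'" | "l' < l" | "l = l'" by linarith
  then show ?thesis
  proof cases
    case 3
    \<comment> \<open>With equal diagonals both trees are rotated to the same comb, and
      \<open>2 * (d - 1)\<close> rotations are within the bound.\<close>
    have lc: "reach rot (d - 1) s (lcomb d)" if "leaves s = d + 1" for s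
      using reach_lcomb[of s] that by simp
    have "reach rot (d - 1 + (d - 1)) t t'"
      using reach_trans[OF lc[OF T(2)] reach_sym[OF lc[OF T'(2)] rot_sym]] .
    then have "reach rot (2 * d - 1 + (d - 1) div 2) t t'"
      by (rule reach_mono) simp
    then show ?thesis
      using reach_rot_flip T T' 3 by simp
  qed (use T T' reach_cs_of_less in simp_all)
qed

end

theorem theorem1:
  fixes d :: nat and p :: "nat \<Rightarrow> real ^ 2" and T T' :: "nat set set"
  assumes "d \<ge> 1"
    and "convex_polygon (2 * d + 2) p"
    and "cs_triangulation d p T"
    and "cs_triangulation d p T'"
  shows "flip_distance d p T T' \<le> enat (nat (\<lceil>5 * real d / 2\<rceil> - 2))"
proof -
  interpret cs_polygon d p using assms(2) by unfold_locales
  \<comment> \<open>Splitting by parity removes both roundings: the common value is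
    \<open>5 * r - 2\<close> for \<open>d = 2 * r\<close> and \<open>5 * r + 1\<close> for
    \<open>d = 2 * r + 1\<close>.\<close>
  have "2 * d - 1 + (d - 1) div 2 = nat (\<lceil>5 * real d / 2\<rceil> - 2)"
  proof (cases "even d")
    case True
    then obtain r where r: "d = 2 * r" by blast
    then have "\<lceil>5 * real d / 2\<rceil> = 5 * int r"
      unfolding ceiling_eq_iff r by simp
    moreover have "(d - 1) div 2 = r - 1" "0 < r" using r assms(1) by auto
    ultimately show ?thesis using r by simp
  next
    case False
    then obtain r where r: "d = 2 * r + 1" by (rule oddE)
    have "\<lceil>5 * real d / 2\<rceil> = 5 * int r + 3"
      unfolding ceiling_eq_iff r by simp
    then show ?thesis using r by simp
  qed
  then show ?thesis
    using flip_distance_le[OF reach_cs_triangulations] assms by simp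
qed

end
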